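(* Let $V$ be an $n$-dimensional vector space over $\mathbb{F}_q$, let $k$ be a positive integer with $k\le n/2$, and let $\mathcal{S}^*$ be a family of $s$ subspaces of $V$ of codimension $k$, with $s\ge 2$, such that for some integer $d\ge2$: (1) for every $v\in V\setminus\{0\}$, $|\{M\in\mathcal{S}^*: v\in M\}|\in\{0,d\}$, with both values occurring; and (2) $\dim(M\cap M^* )=n-2k$ for all distinct $M,M^*\in\mathcal{S}^*$. Let $\mathcal{Y}$ be the set of one-dimensional subspaces $U$ of $V$ with $|\{M\in\mathcal{S}^*: U\subseteq M\}|=d$. Then $\mathcal{Y}$ is a projective $(N,n,h_1,h_2)$ set, where \[ N=\frac{s}{d}\begin{bmatrix} n-k\end{bmatrix}_q,\quad h_1=\frac1d\begin{bmatrix} n-k\end{bmatrix}_q+\frac{s-1}{d}\begin{bmatrix} n-k-1\end{bmatrix}_q,\quad h_2=\frac sd\begin{bmatrix} n-k-1\end{bmatrix}_q. \]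
   Context: For an integer $m\ge0$, $\begin{bmatrix} m\end{bmatrix}_q=\frac{q^m-1}{q-1}$. A projective $(N,K,h_1,h_2)$ set is a proper, non-empty set of $N$ points of the projective space $PG(K-1,q)$ (i.e. one-dimensional subspaces of a $K$-dimensional $\mathbb{F}_q$-vector space) such that every hyperplane contains either exactly $h_1$ or exactly $h_2$ of these points. *)

theory Defs
  imports Complex_Main "HOL-Library.Cardinality"
begin

definition qbracket :: "nat \<Rightarrow> nat \<Rightarrow> rat" where
  "qbracket q m = (of_nat q ^ m - 1) / (of_nat q - 1)"

context finite_dimensional_vector_space
begin

definition proj_points :: "'b set set" where
  "proj_points = {U. subspace U \<and> dim U = 1}"

definition hyperplanes :: "'b set set" where
  "hyperplanes = {H. subspace H \<and> dim H + 1 = dim UNIV}"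

definition projective_set :: "'b set set \<Rightarrow> nat \<Rightarrow> nat \<Rightarrow> nat \<Rightarrow> nat \<Rightarrow> bool" where
  "projective_set Y N K h1 h2 \<longleftrightarrow>
     dim UNIV = K \<and> Y \<noteq> {} \<and> Y \<subset> proj_points \<and> finite Y \<and> card Y = N \<and>
     (\<forall>H \<in> hyperplanes. card {U \<in> Y. U \<subseteq> H} = h1 \<or> card {U \<in> Y. U \<subseteq> H} = h2)"

end

end

theory Submission
  imports Defs "HOL-Library.FuncSet"
begin

text \<open>Two distinct members of \<open>S\<close> span \<open>V\<close>, so a hyperplane \<open>H\<close> contains at most one of them.
  Counting the pairs of a member \<open>M\<close> and a nonzero vector of \<open>M \<inter> H\<close> in two ways shows that
  \<open>H\<close> contains \<open>h1\<close> or \<open>h2\<close> points of \<open>Y\<close> according to whether it contains one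
  member or none; with \<open>V\<close> in place of \<open>H\<close> the same count gives \<open>N\<close>. That \<open>h2\<close> is an integer
  requires a hyperplane containing no member: otherwise the annihilators of the members would
  form a spread of the dual space, and every nonzero vector would lie in equally many
  members, although both \<open>0\<close> and \<open>d\<close> occur.\<close>

section \<open>Cardinalities of subspaces over a finite field\<close>

locale finite_field_vector_space = finite_dimensional_vector_space scale Basis
  for scale :: "'f::{field,finite} \<Rightarrow> 'v::ab_group_add \<Rightarrow> 'v" (infixr \<open>*s\<close> 75)
    and Basis :: "'v set"
begin

text \<open>Adjoining \<open>c\<close> outside \<open>span C\<close> multiplies the size by
  \<open>CARD('f)\<close>: each vector of the larger span is \<open>a *s c + x\<close> for exactly
  one scalar \<open>a\<close> and one \<open>x\<close> in \<open>span C\<close>.\<close>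

lemma card_span_independent:
  assumes "independent C"
  shows "finite (span C) \<and> card (span C) = CARD('f) ^ card C"
proof -
  have "finite C" using assms by (rule finiteI_independent)
  then show ?thesis using assms
  proof (induction C)
    case empty
    then show ?case by simp
  next
    case (insert c C)
    have ind: "independent C" and c: "c \<notin> span C"
      using insert.prems insert.hyps(2) by (auto simp: independent_insert)
    let ?f = "\<lambda>(a, x). a *s c + x"
    have "x \<in> ?f ` (UNIV \<times> span C)" if "x - a *s c \<in> span C" for x a
      using that by (intro image_eqI[of _ _ "(a, x - a *s c)"]) auto
    moreover have "\<exists>b. (a *s c + x) - b *s c \<in> span C" if "x \<in> span C" for a x
      using that by (intro exI[of _ a]) simp
    ultimately have eq: "span (insert c C) = ?f ` (UNIV \<times> span C)"
      unfolding span_insert by auto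
    have "inj_on ?f (UNIV \<times> span C)"
    proof (rule inj_onI, clarify)
      fix a x b y
      assume x: "x \<in> span C" and y: "y \<in> span C" and e: "a *s c + x = b *s c + y"
      then have d: "(a - b) *s c = y - x"
        by (simp add: scale_left_diff_distrib algebra_simps)
      have "a = b"
      proof (rule ccontr)
        assume "a \<noteq> b"
        moreover have "(a - b) *s c \<in> span C"
          using x y unfolding d by (rule span_diff[rotated])
        then have "inverse (a - b) *s (a - b) *s c \<in> span C" by (rule span_scale)
        ultimately show False using c by simp
      qed
      then show "a = b \<and> x = y" using e by simp
    qed
    then show ?case
      using insert.IH[OF ind] insert.hyps by (simp add: eq card_image card_cartesian_product)
  qed
qed

lemma finite_UNIV_vectors: "finite (UNIV :: 'v set)"
  using card_span_independent[OF independent_Basis] by (simp add: span_Basis)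

lemma finite_vectors [simp]: "finite (A :: 'v set)"
  using finite_UNIV_vectors by (rule finite_subset[rotated]) simp

lemma finite_vector_sets [simp]: "finite (\<A> :: 'v set set)"
  using finite_Pow_iff[THEN iffD2, OF finite_UNIV_vectors] by (rule finite_subset[rotated]) simp

lemma card_subspace:
  assumes "subspace W"
  shows "card W = CARD('f) ^ dim W"
proof -
  obtain C where "independent C" "span C = W" "card C = dim W"
    using basis_subspace_exists[OF assms] by metis
  then show ?thesis using card_span_independent by metis
qed

lemma card_nonzero_subspace:
  assumes "subspace W"
  shows "card (W - {0}) = CARD('f) ^ dim W - 1"
  using assms by (simp add: card_Diff_singleton subspace_0 card_subspace)

lemma CARD_field_ge_2: "2 \<le> CARD('f)"
proof -
  have "card {0, 1 :: 'f} \<le> CARD('f)" by (rule card_mono) auto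
  then show ?thesis by simp
qed

section \<open>Linear functionals, annihilators and hyperplanes\<close>

lemma vector_space_pair_field: "vector_space_pair scale ((*) :: 'f \<Rightarrow> 'f \<Rightarrow> 'f)"
proof -
  interpret F: vector_space "(*) :: 'f \<Rightarrow> 'f \<Rightarrow> 'f"
    by unfold_locales (auto simp: algebra_simps)
  show ?thesis by unfold_locales
qed

text \<open>The dual space enters only through plain functions into the field; its dimensions are
  read off from cardinalities.\<close>

definition annihilator :: "'v set \<Rightarrow> ('v \<Rightarrow> 'f) set" where
  "annihilator W = {f. Vector_Spaces.linear scale (*) f \<and> (\<forall>x\<in>W. f x = 0)}"

lemma zero_in_annihilator: "(\<lambda>_. 0) \<in> annihilator W"
proof -
  interpret P: vector_space_pair scale "(*) :: 'f \<Rightarrow> 'f \<Rightarrow> 'f"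
    by (rule vector_space_pair_field)
  show ?thesis by (simp add: annihilator_def P.linear_zero)
qed

text \<open>Extend a basis \<open>A\<close> of \<open>W\<close> to a basis \<open>C\<close> of the
  whole space. A functional is given by arbitrary values on \<open>C\<close>, and it vanishes on
  \<open>W\<close> exactly when those on \<open>A\<close> are zero, so the values on
  \<open>C - A\<close> remain free.\<close>

lemma card_annihilator:
  assumes "subspace W"
  shows "card (annihilator W) = CARD('f) ^ (dim UNIV - dim W)"
    and "finite (annihilator W)"
proof -
  interpret P: vector_space_pair scale "(*) :: 'f \<Rightarrow> 'f \<Rightarrow> 'f"
    by (rule vector_space_pair_field)
  obtain A where A: "finite A" "A \<subseteq> W" "independent A" "span A = W" "card A = dim W"
    by (rule basis_subspace_exists[OF assms])
  obtain C where C: "A \<subseteq> C" "C \<subseteq> UNIV" "independent C" "UNIV \<subseteq> span C"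
    by (rule maximal_independent_subset_extend[OF subset_UNIV A(3)])
  have dimC: "card C = dim UNIV"
    using dim_eq_card[of C UNIV] C by (simp add: top.extremum_unique)
  let ?T = "PiE C (\<lambda>c. if c \<in> A then {0} else UNIV :: 'f set)"
  have bij: "bij_betw (\<lambda>f. restrict f C) (annihilator W) ?T"
  proof (rule bij_betwI')
    fix f g assume fg: "f \<in> annihilator W" "g \<in> annihilator W"
    show "(restrict f C = restrict g C) = (f = g)"
    proof
      assume "restrict f C = restrict g C"
      then have "f b = g b" if "b \<in> C" for b using that by (metis restrict_apply')
      then show "f = g"
        using fg C(4) P.linear_eq_on[of f g _ C] by (auto simp: annihilator_def)
    qed simp
  next
    fix f assume "f \<in> annihilator W"
    then show "restrict f C \<in> ?T"
      using A(4) by (auto simp: annihilator_def span_base)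
  next
    fix g assume g: "g \<in> ?T"
    let ?f = "P.construct C g"
    have lin: "Vector_Spaces.linear scale (*) ?f" using C(3) by (rule P.linear_construct)
    have gA: "?f a = 0" if "a \<in> A" for a
      using that g C P.construct_basis[OF C(3), of a g] by (auto simp: PiE_iff split: if_splits)
    have "?f x = 0" if "x \<in> W" for x
      using P.linear_eq_on[OF lin P.linear_zero, of x A] gA that A(4) by auto
    then have "?f \<in> annihilator W" using lin by (simp add: annihilator_def)
    moreover have "g = restrict ?f C"
      using g P.construct_basis[OF C(3)] by (auto simp: PiE_iff extensional_def)
    ultimately show "\<exists>f\<in>annihilator W. g = restrict f C" by blast
  qed
  have "card ?T = (\<Prod>c\<in>C. if c \<in> A then 1 else CARD('f))"
    by (subst card_PiE) (auto intro!: prod.cong)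
  also have "\<dots> = CARD('f) ^ card (C - A)"
    by (subst prod.If_cases) (auto simp: Diff_eq)
  also have "card (C - A) = dim UNIV - dim W"
    using C(1) A(5) dimC by (simp add: card_Diff_subset)
  finally show "card (annihilator W) = CARD('f) ^ (dim UNIV - dim W)"
    using bij_betw_same_card[OF bij] by simp
  have "finite ?T" by (rule finite_PiE) auto
  then show "finite (annihilator W)" using bij_betw_finite[OF bij] by simp
qed

text \<open>If \<open>f x\<close> is nonzero, subtracting a suitable multiple of \<open>x\<close>
  moves any vector into the kernel, so the kernel and \<open>x\<close> together span
  everything.\<close>

lemma kernel_in_hyperplanes:
  assumes "Vector_Spaces.linear scale (*) f" "f \<noteq> (\<lambda>_. 0)"
  shows "{x. f x = 0} \<in> hyperplanes"
proof -
  interpret f: Vector_Spaces.linear scale "(*)" f by fact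
  have sub: "subspace {x. f x = 0}" by (rule f.subspace_kernel)
  obtain x where x: "f x \<noteq> 0" using assms(2) by auto
  have "y \<in> span (insert x {x. f x = 0})" for y
  proof -
    have "f (y - (f y / f x) *s x) = 0" using x by (simp add: f.diff f.scale)
    then have "y - (f y / f x) *s x \<in> span {x. f x = 0}" by (intro span_base) simp
    then show ?thesis unfolding span_insert by blast
  qed
  then have "span (insert x {x. f x = 0}) = UNIV" by auto
  then have "dim UNIV = dim (insert x {x. f x = 0})" by (metis dim_span)
  also have "\<dots> = dim {x. f x = 0} + 1"
    unfolding dim_insert span_eq_iff[THEN iffD2, OF sub] using x by simp
  finally show ?thesis using sub by (simp add: hyperplanes_def)
qed

text \<open>The annihilator of a proper subspace has at least \<open>CARD('f)\<close> elements,
  hence a nonzero one, whose kernel serves.\<close>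

lemma hyperplane_containing:
  assumes "subspace W" "dim W < dim UNIV"
  obtains H where "H \<in> hyperplanes" "W \<subseteq> H"
proof -
  have "CARD('f) ^ 1 \<le> card (annihilator W)"
    unfolding card_annihilator(1)[OF assms(1)] using assms(2) CARD_field_ge_2
    by (intro power_increasing) auto
  then have "\<not> annihilator W \<subseteq> {\<lambda>_. 0}"
    using CARD_field_ge_2 card_mono[of "{\<lambda>_. 0}" "annihilator W"] by fastforce
  then obtain f where "f \<in> annihilator W" "f \<noteq> (\<lambda>_. 0)" by blast
  then show ?thesis
    using that[OF kernel_in_hyperplanes[of f]] by (auto simp: annihilator_def)
qed

text \<open>The sum of \<open>M\<close> and \<open>H\<close> properly contains \<open>H\<close> and
  so is the whole space; the dimension formula for sums does the rest.\<close>

lemma dim_Int_hyperplane: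
  assumes "subspace M" "H \<in> hyperplanes" "\<not> M \<subseteq> H"
  shows "dim (M \<inter> H) + 1 = dim M"
proof -
  have H: "subspace H" "dim H + 1 = dim UNIV" using assms(2) by (auto simp: hyperplanes_def)
  let ?P = "{x + y |x y. x \<in> M \<and> y \<in> H}"
  have P: "subspace ?P" by (rule subspace_sums) fact+
  have "H \<subseteq> ?P"
    using subspace_0[OF assms(1)] by force
  moreover have "M \<subseteq> ?P"
    using subspace_0[OF H(1)] by force
  ultimately have "\<not> dim ?P \<le> dim H"
    using subspace_dim_equal[OF H(1) P] assms(3) by blast
  moreover have "dim ?P \<le> dim UNIV" by (rule dim_subset) simp
  ultimately have "dim ?P = dim UNIV" using H(2) by linarith
  then show ?thesis using dim_sums_Int[OF assms(1) H(1)] H(2) by linarith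
qed

section \<open>Projective points and the double count\<close>

lemma proj_points_eq_span:
  assumes "U \<in> proj_points" "v \<in> U" "v \<noteq> 0"
  shows "U = span {v}"
proof -
  have U: "subspace U" "dim U = 1" using assms(1) by (auto simp: proj_points_def)
  show ?thesis
    by (rule subspace_dim_equal[symmetric]) (use U assms in \<open>auto simp: span_minimal\<close>)
qed

lemma span_in_proj_points: "v \<noteq> 0 \<Longrightarrow> span {v} \<in> proj_points"
  by (simp add: proj_points_def)

text \<open>Distinct points share only the zero vector, and each has \<open>CARD('f) - 1\<close>
  nonzero vectors.\<close>

lemma card_Union_proj_points:
  assumes "\<U> \<subseteq> proj_points"
  shows "card (\<Union>\<U> - {0}) = (CARD('f) - 1) * card \<U>"
proof -
  have "\<Union>\<U> - {0} = (\<Union>U\<in>\<U>. U - {0})" by auto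
  also have "card \<dots> = (\<Sum>U\<in>\<U>. card (U - {0}))"
  proof (rule card_UN_disjoint)
    show "\<forall>U\<in>\<U>. \<forall>U'\<in>\<U>. U \<noteq> U' \<longrightarrow> (U - {0}) \<inter> (U' - {0}) = {}"
      using assms proj_points_eq_span by blast
  qed auto
  also have "\<dots> = (\<Sum>U\<in>\<U>. CARD('f) - 1)"
    using assms by (intro sum.cong) (auto simp: proj_points_def card_nonzero_subspace)
  finally show ?thesis by simp
qed

lemma subset_subspace_iff_proj_point:
  assumes "U \<in> proj_points" "v \<in> U" "v \<noteq> 0" "subspace W"
  shows "U \<subseteq> W \<longleftrightarrow> v \<in> W"
  using proj_points_eq_span[OF assms(1-3)] assms(2,4) span_minimal[of "{v}" W] by blast

text \<open>Both sides count pairs of a member \<open>M\<close> and a nonzero vector of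
  \<open>M\<close> in \<open>W\<close>. An arbitrary subspace \<open>W\<close> covers the whole
  space and the hyperplanes at once.\<close>

lemma double_count_points:
  fixes S :: "'v set set"
  assumes S: "\<And>M. M \<in> S \<Longrightarrow> subspace M"
    and count: "\<And>v. v \<noteq> 0 \<Longrightarrow> card {M \<in> S. v \<in> M} \<in> {0, d}" and "0 < d"
    and W: "subspace W"
  shows "d * ((CARD('f) - 1) * card {U \<in> proj_points. card {M \<in> S. U \<subseteq> M} = d \<and> U \<subseteq> W})
       = (\<Sum>M\<in>S. CARD('f) ^ dim (M \<inter> W) - 1)"
proof -
  let ?Y = "{U \<in> proj_points. card {M \<in> S. U \<subseteq> M} = d \<and> U \<subseteq> W}"
  let ?c = "\<lambda>v. card {M \<in> S. v \<in> M}"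
  have same: "{M \<in> S. U \<subseteq> M} = {M \<in> S. v \<in> M}" if "U \<in> proj_points" "v \<in> U" "v \<noteq> 0" for U v
    using subset_subspace_iff_proj_point[OF that] S by auto
  \<comment> \<open>A nonzero vector and the point it spans lie in the same members, so points
    covered \<open>d\<close> times correspond to vectors covered \<open>d\<close> times.\<close>
  have Un: "\<Union>?Y - {0} = {v \<in> W - {0}. ?c v = d}"
  proof (intro equalityI subsetI)
    fix v assume "v \<in> \<Union>?Y - {0}"
    then show "v \<in> {v \<in> W - {0}. ?c v = d}" using same by auto
  next
    fix v assume v: "v \<in> {v \<in> W - {0}. ?c v = d}"
    have p: "span {v} \<in> proj_points" "v \<in> span {v}"
      using v by (auto intro: span_in_proj_points span_base)
    then have "span {v} \<in> ?Y"
      using v same[OF p] subset_subspace_iff_proj_point[OF p _ W] by auto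
    then show "v \<in> \<Union>?Y - {0}" using p v by blast
  qed
  have "d * ((CARD('f) - 1) * card ?Y) = d * card {v \<in> W - {0}. ?c v = d}"
    using card_Union_proj_points[of ?Y] Un by auto
  also have "\<dots> = (\<Sum>v\<in>{v \<in> W - {0}. ?c v = d}. ?c v)" by simp
  \<comment> \<open>The added vectors lie in no member and contribute 0.\<close>
  also have "\<dots> = (\<Sum>v\<in>W - {0}. ?c v)"
    using count by (intro sum.mono_neutral_left) auto
  also have "\<dots> = (\<Sum>M\<in>S. card {v \<in> W - {0}. v \<in> M})"
    using sum.swap_restrict[of "W - {0}" S "\<lambda>_ _. 1 :: nat" "(\<in>)"] by simp
  also have "\<dots> = (\<Sum>M\<in>S. CARD('f) ^ dim (M \<inter> W) - 1)"
  proof (rule sum.cong[OF refl])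
    fix M assume "M \<in> S"
    have "{v \<in> W - {0}. v \<in> M} = (M \<inter> W) - {0}" by auto
    then show "card {v \<in> W - {0}. v \<in> M} = CARD('f) ^ dim (M \<inter> W) - 1"
      using card_nonzero_subspace[OF subspace_inter[OF S[OF \<open>M \<in> S\<close>] W]] by simp
  qed
  finally show ?thesis .
qed

section \<open>A hyperplane that contains no member\<close>

text \<open>If every hyperplane contains exactly one member of \<open>S\<close>, then the annihilators of the members
  partition the nonzero functionals. Counting the functionals that also vanish at \<open>v\<close> then
  determines the number of members through \<open>v\<close>, whatever \<open>v \<noteq> 0\<close> is.\<close>

lemma hyperplane_partition_count:
  fixes S :: "'v set set"
  assumes S: "\<And>M. M \<in> S \<Longrightarrow> subspace M \<and> dim M + k = dim UNIV" and k: "0 < k"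
    and one: "\<And>H. H \<in> hyperplanes \<Longrightarrow> \<exists>!M. M \<in> S \<and> M \<subseteq> H"
    and v: "v \<noteq> 0"
  shows "card {M \<in> S. v \<in> M} * (CARD('f) ^ k - 1)
       + (card S - card {M \<in> S. v \<in> M}) * (CARD('f) ^ (k - 1) - 1)
       = CARD('f) ^ (dim UNIV - 1) - 1"
proof -
  let ?z = "\<lambda>_. 0 :: 'f"
  \<comment> \<open>The functionals that vanish on \<open>W\<close> and at \<open>v\<close>; for
    \<open>W = {}\<close> only the condition at \<open>v\<close> remains. The span provides the
    subspace required by \<open>card_annihilator\<close>.\<close>
  let ?A = "\<lambda>W. annihilator (span (insert v W))"
  have ann: "f \<in> ?A W \<longleftrightarrow> Vector_Spaces.linear scale (*) f \<and> f v = 0 \<and> (\<forall>x\<in>W. f x = 0)" for f W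
  proof (cases "Vector_Spaces.linear scale (*) f")
    case True
    interpret f: Vector_Spaces.linear scale "(*)" f by fact
    have "\<forall>x\<in>span (insert v W). f x = 0" if "f v = 0" "\<forall>x\<in>W. f x = 0"
      using f.eq_0_on_span[of "insert v W"] that by auto
    then show ?thesis using True by (auto simp: annihilator_def span_base)
  qed (simp add: annihilator_def)
  have card_A: "card (?A W - {?z}) = CARD('f) ^ (dim UNIV - dim (insert v W)) - 1" for W
    using card_annihilator[of "span (insert v W)"] zero_in_annihilator
    by (simp add: card_Diff_singleton)
  \<comment> \<open>The kernel of a nonzero functional is a hyperplane, so it contains a member;
    uniqueness of that member makes the union disjoint.\<close>
  have "?A {} - {?z} = (\<Union>M\<in>S. ?A M - {?z})"
  proof (intro equalityI subsetI)
    fix f assume f: "f \<in> ?A {} - {?z}"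
    then have "Vector_Spaces.linear scale (*) f" "f \<noteq> ?z" by (auto simp: ann)
    then obtain M where "M \<in> S" "M \<subseteq> {x. f x = 0}"
      using one[OF kernel_in_hyperplanes] by blast
    then show "f \<in> (\<Union>M\<in>S. ?A M - {?z})" using f by (auto simp: ann)
  next
    fix f assume "f \<in> (\<Union>M\<in>S. ?A M - {?z})"
    then show "f \<in> ?A {} - {?z}" by (auto simp: ann)
  qed
  moreover have "card (\<Union>M\<in>S. ?A M - {?z}) = (\<Sum>M\<in>S. card (?A M - {?z}))"
  proof (rule card_UN_disjoint)
    show "\<forall>M\<in>S. \<forall>M'\<in>S. M \<noteq> M' \<longrightarrow> (?A M - {?z}) \<inter> (?A M' - {?z}) = {}"
    proof (intro ballI impI, rule ccontr)
      fix M M' assume M: "M \<in> S" "M' \<in> S" "M \<noteq> M'"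
        and "(?A M - {?z}) \<inter> (?A M' - {?z}) \<noteq> {}"
      then obtain f where f: "f \<in> ?A M" "f \<in> ?A M'" "f \<noteq> ?z" by blast
      then have "M \<subseteq> {x. f x = 0}" "M' \<subseteq> {x. f x = 0}" "{x. f x = 0} \<in> hyperplanes"
        using kernel_in_hyperplanes[of f] by (auto simp: ann)
      then show False using one M by blast
    qed
  qed (auto simp: card_annihilator(2))
  ultimately have "CARD('f) ^ (dim UNIV - 1) - 1 = (\<Sum>M\<in>S. card (?A M - {?z}))"
    using card_A[of "{}"] v by simp
  \<comment> \<open>Inserting \<open>v\<close> into \<open>M\<close> raises the dimension by one
    unless \<open>v\<close> lies in \<open>M\<close> already, which leaves codimension
    \<open>k - 1\<close> or \<open>k\<close>.\<close>
  also have "\<dots> = (\<Sum>M\<in>S. if v \<in> M then CARD('f) ^ k - 1 else CARD('f) ^ (k - 1) - 1)"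
  proof (rule sum.cong[OF refl])
    fix M assume "M \<in> S"
    then have M: "span M = M" "dim M + k = dim UNIV" using S span_eq_iff by auto
    have "dim UNIV - dim M = k" "dim UNIV - (dim M + 1) = k - 1"
      using M(2) by linarith+
    then show "card (?A M - {?z}) = (if v \<in> M then CARD('f) ^ k - 1 else CARD('f) ^ (k - 1) - 1)"
      unfolding card_A dim_insert M(1) by simp
  qed
  also have "\<dots> = card {M \<in> S. v \<in> M} * (CARD('f) ^ k - 1)
       + card (S - {M \<in> S. v \<in> M}) * (CARD('f) ^ (k - 1) - 1)"
    by (subst sum.If_cases) (auto simp: Int_def Diff_eq Compl_eq intro!: arg_cong[where f = card])
  also have "card (S - {M \<in> S. v \<in> M}) = card S - card {M \<in> S. v \<in> M}"
    by (rule card_Diff_subset) auto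
  finally show ?thesis by simp
qed

text \<open>Otherwise the partition count would apply to both \<open>v\<close> and \<open>w\<close>.
  Since \<open>CARD('f) ^ k - 1\<close> exceeds \<open>CARD('f) ^ (k - 1) - 1\<close>, that count is
  injective in the number of members through the vector, which contradicts
  \<open>ne\<close>.\<close>

lemma hyperplane_containing_none:
  fixes S :: "'v set set"
  assumes S: "\<And>M. M \<in> S \<Longrightarrow> subspace M \<and> dim M + k = dim UNIV" and k: "0 < k"
    and at_most_one: "\<And>H M M'. H \<in> hyperplanes \<Longrightarrow> M \<in> S \<Longrightarrow> M' \<in> S \<Longrightarrow> M \<subseteq> H \<Longrightarrow> M' \<subseteq> H \<Longrightarrow> M = M'"
    and v: "v \<noteq> 0" and w: "w \<noteq> 0"
    and ne: "card {M \<in> S. v \<in> M} \<noteq> card {M \<in> S. w \<in> M}"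
  shows "\<exists>H\<in>hyperplanes. \<forall>M\<in>S. \<not> M \<subseteq> H"
proof (rule ccontr)
  assume "\<not> ?thesis"
  then have one: "\<exists>!M. M \<in> S \<and> M \<subseteq> H" if "H \<in> hyperplanes" for H
    using at_most_one that by blast
  define a where "a = CARD('f) ^ (k - 1) - 1"
  define b where "b = CARD('f) ^ k - 1"
  have pos: "1 \<le> CARD('f) ^ (k - 1)" using CARD_field_ge_2 by simp
  have "CARD('f) ^ (k - 1) < CARD('f) ^ k"
    using k CARD_field_ge_2 by (intro power_strict_increasing) auto
  then have ab: "a < b" using pos unfolding a_def b_def by linarith
  have le: "card {M \<in> S. u \<in> M} \<le> card S" for u by (rule card_mono) auto
  \<comment> \<open>Over the integers the truncated subtractions disappear and the equation
    factors.\<close>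
  define x where "x = int (card {M \<in> S. v \<in> M})"
  define y where "y = int (card {M \<in> S. w \<in> M})"
  have "card {M \<in> S. v \<in> M} * b + (card S - card {M \<in> S. v \<in> M}) * a
      = card {M \<in> S. w \<in> M} * b + (card S - card {M \<in> S. w \<in> M}) * a"
    using hyperplane_partition_count[OF S k one v] hyperplane_partition_count[OF S k one w]
    unfolding a_def b_def by simp
  then have "int (card {M \<in> S. v \<in> M} * b + (card S - card {M \<in> S. v \<in> M}) * a)
      = int (card {M \<in> S. w \<in> M} * b + (card S - card {M \<in> S. w \<in> M}) * a)"
    by (rule arg_cong)
  then have "x * int b + (int (card S) - x) * int a = y * int b + (int (card S) - y) * int a"
    unfolding x_def y_def by (simp add: of_nat_diff le)
  then have "(x - y) * (int b - int a) = 0" by (simp add: algebra_simps)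
  then show False using ab ne by (simp add: x_def y_def)
qed

end

section \<open>The intersection numbers and the parameters\<close>

lemma qbracket_of_nat:
  assumes "2 \<le> q"
  shows "qbracket q m = of_nat (q ^ m - 1) / of_nat (q - 1)"
  using assms by (simp add: qbracket_def of_nat_diff)

theorem theorem5p5:
  fixes scale :: "'f::{field,finite} \<Rightarrow> 'v::ab_group_add \<Rightarrow> 'v"
    and B :: "'v set" and S :: "'v set set" and Y :: "'v set set"
    and q n k s d :: nat
  assumes V: "finite_dimensional_vector_space scale B"
    and q: "q = CARD('f)"
    and n: "vector_space.dim scale (UNIV :: 'v set) = n"
    and k: "0 < k" "2 * k \<le> n"
    and S: "\<And>M. M \<in> S \<Longrightarrow> module.subspace scale M \<and> vector_space.dim scale M + k = n"
    and s: "finite S" "card S = s" "2 \<le> s"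
    and d: "2 \<le> d"
    and count: "\<And>v. v \<noteq> 0 \<Longrightarrow> card {M \<in> S. v \<in> M} \<in> {0, d}"
    and occurs_0: "\<exists>v. v \<noteq> 0 \<and> card {M \<in> S. v \<in> M} = 0"
    and occurs_d: "\<exists>v. v \<noteq> 0 \<and> card {M \<in> S. v \<in> M} = d"
    and inter: "\<And>M M'. M \<in> S \<Longrightarrow> M' \<in> S \<Longrightarrow> M \<noteq> M' \<Longrightarrow>
                  vector_space.dim scale (M \<inter> M') = n - 2 * k"
    and Y: "Y = {U \<in> finite_dimensional_vector_space.proj_points scale.
                  card {M \<in> S. U \<subseteq> M} = d}"
  shows "\<exists>N h1 h2 :: nat.
           of_nat N = of_nat s / of_nat d * qbracket q (n - k) \<and>
           of_nat h1 = 1 / of_nat d * qbracket q (n - k)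
                       + (of_nat s - 1) / of_nat d * qbracket q (n - k - 1) \<and>
           of_nat h2 = of_nat s / of_nat d * qbracket q (n - k - 1) \<and>
           finite_dimensional_vector_space.projective_set scale Y N n h1 h2"
proof -
  interpret finite_dimensional_vector_space scale B by fact
  interpret finite_field_vector_space scale B ..
  \<comment> \<open>Keeps \<open>dim UNIV\<close> intact so that \<open>n\<close> can rewrite
    it.\<close>
  note [simp del] = dim_UNIV
  have q2: "2 \<le> q" using CARD_field_ge_2 q by simp
  have subS: "subspace M" and dimS: "dim M = n - k" if "M \<in> S" for M
    using S[OF that] by auto
  have S': "subspace M \<and> dim M + k = dim UNIV" if "M \<in> S" for M
    using S[OF that] n by simp
  let ?g = "\<lambda>W. card {U \<in> Y. U \<subseteq> W}"
  let ?a = "q ^ (n - k) - 1" and ?b = "q ^ (n - k - 1) - 1"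
  have Y_sub: "{U \<in> Y. U \<subseteq> W} = {U \<in> proj_points. card {M \<in> S. U \<subseteq> M} = d \<and> U \<subseteq> W}" for W
    using Y by auto
  have double: "d * ((q - 1) * ?g W) = (\<Sum>M\<in>S. q ^ dim (M \<inter> W) - 1)" if "subspace W" for W
    using double_count_points[OF subS count _ that] d unfolding Y_sub q by simp
  have at_most_one: "M = M'"
    if H: "H \<in> hyperplanes" and M: "M \<in> S" "M' \<in> S" "M \<subseteq> H" "M' \<subseteq> H" for H M M'
  proof (rule ccontr)
    assume ne: "M \<noteq> M'"
    have subH: "subspace H" "dim H + 1 = n" using H n by (auto simp: hyperplanes_def)
    \<comment> \<open>This sum has dimension 2(n-k) - (n-2k) = n, too large for \<open>H\<close>;
      the bound on \<open>k\<close> makes the natural subtraction exact.\<close>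
    have "{x + y |x y. x \<in> M \<and> y \<in> M'} \<subseteq> H" using M subH(1) by (auto intro: subspace_add)
    then have "dim {x + y |x y. x \<in> M \<and> y \<in> M'} \<le> dim H" by (rule dim_subset)
    then show False
      using dim_sums_Int[OF subS[OF M(1)] subS[OF M(2)]] inter[OF M(1,2) ne]
        dimS[OF M(1)] dimS[OF M(2)] subH(2) k by linarith
  qed
  have dimH: "q ^ dim (M \<inter> H) - 1 = (if M \<subseteq> H then ?a else ?b)"
    if "M \<in> S" "H \<in> hyperplanes" for M H
  proof (cases "M \<subseteq> H")
    case True
    then show ?thesis using dimS[OF that(1)] by (simp add: Int_absorb2)
  next
    case False
    then have "dim (M \<inter> H) = n - k - 1"
      using dim_Int_hyperplane[OF subS[OF that(1)] that(2)] dimS[OF that(1)] by linarith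
    then show ?thesis using False by simp
  qed
  have double_H: "d * ((q - 1) * ?g H) = (\<Sum>M\<in>S. if M \<subseteq> H then ?a else ?b)"
    if "H \<in> hyperplanes" for H
    using double[of H] that dimH by (simp add: hyperplanes_def)
  have some: "d * ((q - 1) * ?g H) = ?a + (s - 1) * ?b"
    if H: "H \<in> hyperplanes" "M \<in> S" "M \<subseteq> H" for H M
  proof -
    have "(\<Sum>M'\<in>S. if M' \<subseteq> H then ?a else ?b) = ?a + (\<Sum>M'\<in>S - {M}. if M' \<subseteq> H then ?a else ?b)"
      using H s(1) by (simp add: sum.remove)
    also have "(\<Sum>M'\<in>S - {M}. if M' \<subseteq> H then ?a else ?b) = (\<Sum>M'\<in>S - {M}. ?b)"
      using at_most_one[OF H(1)] H by (intro sum.cong) auto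
    finally show ?thesis using double_H[OF H(1)] H(2) s by simp
  qed
  have none: "d * ((q - 1) * ?g H) = s * ?b"
    if H: "H \<in> hyperplanes" "\<And>M. M \<in> S \<Longrightarrow> \<not> M \<subseteq> H" for H
    using double_H[OF H(1)] H(2) s by simp
  have total: "d * ((q - 1) * card Y) = s * ?a"
    using double[OF subspace_UNIV] dimS s by simp
  obtain v0 where v0: "v0 \<noteq> 0" "card {M \<in> S. v0 \<in> M} = 0" using occurs_0 by blast
  obtain vd where vd: "vd \<noteq> 0" "card {M \<in> S. vd \<in> M} = d" using occurs_d by blast
  obtain M0 where M0: "M0 \<in> S" using s by fastforce
  \<comment> \<open>\<open>h1\<close> and \<open>h2\<close> will be the point counts of the actual
    hyperplanes \<open>H1\<close> and \<open>H2\<close>, so they are natural numbers from the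
    outset.\<close>
  obtain H1 where H1: "H1 \<in> hyperplanes" "M0 \<subseteq> H1"
    using hyperplane_containing[OF subS[OF M0]] S'[OF M0] k by (metis less_add_same_cancel1)
  have ne: "card {M \<in> S. v0 \<in> M} \<noteq> card {M \<in> S. vd \<in> M}"
    unfolding v0(2) vd(2) using d by simp
  have "\<exists>H\<in>hyperplanes. \<forall>M\<in>S. \<not> M \<subseteq> H"
    by (rule hyperplane_containing_none[OF S' k(1) at_most_one v0(1) vd(1) ne])
  then obtain H2 where H2: "H2 \<in> hyperplanes" "\<And>M. M \<in> S \<Longrightarrow> \<not> M \<subseteq> H2"
    by blast
  have none_H2: "d * ((q - 1) * ?g H2) = s * ?b" using H2 by (rule none)
  have sp: "{M \<in> S. span {v} \<subseteq> M} = {M \<in> S. v \<in> M}" for v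
    using subS span_minimal span_base by blast
  \<comment> \<open>The vector covered \<open>d\<close> times makes \<open>Y\<close> nonempty; the
    uncovered one makes it a proper subset.\<close>
  have "span {vd} \<in> Y" unfolding Y using sp[of vd] vd span_in_proj_points by auto
  moreover have "span {v0} \<in> proj_points - Y" 
    unfolding Y mem_Collect_eq Diff_iff sp v0(2) using v0(1) d span_in_proj_points by auto
  moreover have "Y \<subseteq> proj_points" using Y by auto
  \<comment> \<open>The product equations depend only on whether \<open>H\<close> contains a member,
    and the positive factors \<open>d\<close> and \<open>q - 1\<close> cancel.\<close>
  moreover have "?g H = ?g H1 \<or> ?g H = ?g H2" if H: "H \<in> hyperplanes" for H
  proof (cases "\<exists>M\<in>S. M \<subseteq> H")
    case True
    then have "d * ((q - 1) * ?g H) = d * ((q - 1) * ?g H1)"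
      using some[OF H1(1) M0 H1(2)] some[OF H] by auto
    then show ?thesis using d q2 by simp
  next
    case False
    then have "d * ((q - 1) * ?g H) = d * ((q - 1) * ?g H2)"
      using none_H2 none[OF H] by auto
    then show ?thesis using d q2 by simp
  qed
  ultimately have proj: "projective_set Y (card Y) n (?g H1) (?g H2)"
    unfolding projective_set_def using n by auto
  \<comment> \<open>Turns the product equations over the naturals into exact rational
    quotients.\<close>
  have div: "(of_nat g :: rat) = of_nat x / (of_nat d * of_nat (q - 1))"
    if "d * ((q - 1) * g) = x" for g x
    using d q2 by (simp add: that[symmetric] field_simps)
  have s1: "of_nat (s - 1) = (of_nat s - 1 :: rat)" using s by (simp add: of_nat_diff)
  have "of_nat (card Y) = of_nat s / of_nat d * qbracket q (n - k)"
    unfolding div[OF total] qbracket_of_nat[OF q2] by simp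
  moreover have "of_nat (?g H1) = 1 / of_nat d * qbracket q (n - k)
      + (of_nat s - 1) / of_nat d * qbracket q (n - k - 1)"
    unfolding div[OF some[OF H1(1) M0 H1(2)]] qbracket_of_nat[OF q2] s1[symmetric]
    by (simp add: add_divide_distrib)
  moreover have "of_nat (?g H2) = of_nat s / of_nat d * qbracket q (n - k - 1)"
    unfolding div[OF none_H2] qbracket_of_nat[OF q2] by simp
  ultimately show ?thesis using proj by blast
qed

end
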